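(* For any $n,d\in\mathbb{N}$ there exists a finite simple connected graph $G$ with $|V(G)|\ge n$ and $\operatorname{diam}(G)\ge d$ such that $G$ is DMR but not CDDR.
   Context: All graphs are finite, simple and connected. $\Gamma_i(u)$ is the set of vertices at distance exactly $i$ from $u$. $G$ is CDDR (commutative distance degree-regular) if $|\Gamma_i(u)\cap\Gamma_j(v)|=|\Gamma_i(v)\cap\Gamma_j(u)|$ for all vertices $u,v$ and all $1\le i,j\le\operatorname{diam}(G)$. $G$ is DMR (distance mean-regular) if for all $0\le h,i,j\le\operatorname{diam}(G)$ the average $\frac{1}{|\Gamma_h(u)|}\sum_{v\in\Gamma_h(u)}|\Gamma_i(u)\cap\Gamma_j(v)|$ depends only on $h,i,j$ and not on the vertex $u$. *)

theory Defs
  imports Complex_Main "Graph_Theory.Pair_Digraph" "Graph_Theory.Digraph_Component"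
begin

text \<open>
  Finite simple graphs are the \<open>pair_graph\<close>s of the library, that is, finite symmetric loop-free
  digraphs without parallel arcs. The notions below are meant for connected graphs, on which every
  \<open>LEAST\<close> and \<open>Max\<close> ranges over a nonempty set.
\<close>

definition gdist :: "('a, 'b) pre_digraph \<Rightarrow> 'a \<Rightarrow> 'a \<Rightarrow> nat" where
  "gdist G u v = (LEAST k. \<exists>p. pre_digraph.awalk G u p v \<and> length p = k)"

definition diam :: "('a, 'b) pre_digraph \<Rightarrow> nat" where
  "diam G = Max {gdist G u v | u v. u \<in> verts G \<and> v \<in> verts G}"

definition sphere :: "('a, 'b) pre_digraph \<Rightarrow> nat \<Rightarrow> 'a \<Rightarrow> 'a set" where
  "sphere G i u = {v \<in> verts G. gdist G u v = i}"

text \<open>Commutative distance degree-regular graphs.\<close>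

definition cddr :: "('a, 'b) pre_digraph \<Rightarrow> bool" where
  "cddr G \<longleftrightarrow> (\<forall>u \<in> verts G. \<forall>v \<in> verts G. \<forall>i \<in> {1..diam G}. \<forall>j \<in> {1..diam G}.
     card (sphere G i u \<inter> sphere G j v) = card (sphere G i v \<inter> sphere G j u))"

definition mean_intersection :: "('a, 'b) pre_digraph \<Rightarrow> nat \<Rightarrow> nat \<Rightarrow> nat \<Rightarrow> 'a \<Rightarrow> real" where
  "mean_intersection G h i j u =
     (\<Sum>v \<in> sphere G h u. real (card (sphere G i u \<inter> sphere G j v))) / real (card (sphere G h u))"

text \<open>
  Distance mean-regular graphs. The value \<open>0 / 0 = 0\<close> of a mean over an empty sphere plays no role:
  for \<open>h = 0\<close> and \<open>i = j\<close> the mean is \<open>card (sphere G i u)\<close>, so the condition forces all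
  spheres of a given radius to have the same size, and those of radius at most \<open>diam G\<close> to be
  nonempty.
\<close>

definition dmr :: "('a, 'b) pre_digraph \<Rightarrow> bool" where
  "dmr G \<longleftrightarrow> (\<forall>h \<in> {0..diam G}. \<forall>i \<in> {0..diam G}. \<forall>j \<in> {0..diam G}.
     \<forall>u \<in> verts G. \<forall>u' \<in> verts G. mean_intersection G h i j u = mean_intersection G h i j u')"

end

theory Submission
  imports Defs
begin

text \<open>
  In a vertex-transitive graph the average defining distance mean-regularity cannot depend on the
  base vertex, because an automorphism preserves distances and hence carries every sphere and every
  intersection of spheres to one of equal size. So it suffices to find arbitrarily large
  vertex-transitive graphs of arbitrarily large diameter that are not CDDR. Since the cardinality of
  \<open>\<Gamma>\<^sub>i(u) \<inter> \<Gamma>\<^sub>j(v)\<close> is the \<open>(u, v)\<close> entry of the product of the \<open>i\<close>-th and the \<open>j\<close>-th distance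
  matrix, CDDR says that the distance matrices commute. In a Cayley graph of an abelian group they
  always do; the graphs below are Cayley graphs of dihedral groups.

  On the integers modulo \<open>2m\<close> join every even \<open>a\<close> to \<open>a + 1\<close>, \<open>a + 3\<close> and \<open>a + 7\<close>. Translations by
  even numbers and reflections \<open>x \<mapsto> c - x\<close> with \<open>c\<close> odd are automorphisms, and together they act
  transitively (\<open>haar_graph_vertex_transitive\<close>, \<open>vertex_transitive_imp_dmr\<close>). A step moves
  by at most \<open>7\<close>, so the vertex \<open>m\<close> is at distance at least \<open>m / 7\<close> from \<open>0\<close> (\<open>diam_haar_graph\<close>).

  A walk of length three from an even vertex moves by \<open>k - l + n\<close> with \<open>k, l, n \<in> {1, 3, 7}\<close>,
  which ranges from \<open>-5\<close> to \<open>13\<close> and so favours the positive direction. Compare \<open>u = 0\<close> and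
  \<open>v = 10\<close>: the neighbours \<open>11\<close> and \<open>13\<close> of \<open>v\<close> are at distance \<open>3\<close> from \<open>u\<close>, whereas the
  neighbours \<open>1\<close> and \<open>3\<close> of \<open>u\<close> are not at distance \<open>3\<close> from \<open>v\<close>, as this would take a
  displacement of \<open>-9\<close> or \<open>-7\<close>. Hence
  \<open>|\<Gamma>\<^sub>1(u) \<inter> \<Gamma>\<^sub>3(v)| \<le> 1 < 2 \<le> |\<Gamma>\<^sub>1(v) \<inter> \<Gamma>\<^sub>3(u)|\<close> (\<open>not_cddr_haar_graph\<close>).
\<close>

section \<open>Distances and walks\<close>

lemma relpow_Suc_iff: "(x, z) \<in> R ^^ Suc n \<longleftrightarrow> (\<exists>y. (x, y) \<in> R \<and> (y, z) \<in> R ^^ n)"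
  by (meson relpow_Suc_D2 relpow_Suc_I2)

text \<open>
  Distances only involve lengths of walks, so walks can be traded for powers of the arc relation,
  whose parity and displacement properties follow by induction on the exponent.
\<close>

lemma awalk_iff_relpow:
  assumes "pair_wf_digraph G"
  shows "(\<exists>p. pre_digraph.awalk (with_proj G) u p v \<and> length p = k)
           \<longleftrightarrow> u \<in> pverts G \<and> (u, v) \<in> parcs G ^^ k"
proof -
  interpret pair_wf_digraph G by fact
  show ?thesis
  proof (induction k arbitrary: u)
    case 0
    then show ?case by (auto simp: awalk_Nil_iff)
  next
    case (Suc k)
    have "(\<exists>p. awalk u p v \<and> length p = Suc k)
            \<longleftrightarrow> (\<exists>w. (u, w) \<in> parcs G \<and> (\<exists>p. awalk w p v \<and> length p = k))"
    proof -
      have "(\<exists>p. awalk u p v \<and> length p = Suc k) \<longleftrightarrow> (\<exists>e p. awalk u (e # p) v \<and> length p = k)"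
        by (metis length_Suc_conv)
      then show ?thesis
        by (simp add: awalk_Cons_iff)
    qed
    also have "\<dots> \<longleftrightarrow> u \<in> pverts G \<and> (u, v) \<in> parcs G ^^ Suc k"
      unfolding Suc.IH by (auto simp: relpow_Suc_iff simp del: relpow.simps dest: in_arcsD1 in_arcsD2)
    finally show ?case .
  qed
qed

lemma gdist_eq_Least_relpow:
  assumes "pair_wf_digraph G" "u \<in> pverts G"
  shows "gdist (with_proj G) u v = (LEAST k. (u, v) \<in> parcs G ^^ k)"
  using assms by (simp add: gdist_def awalk_iff_relpow)

lemma gdist_eqI:
  assumes "pair_wf_digraph G" "u \<in> pverts G"
    and "(u, v) \<in> parcs G ^^ k" "\<And>j. (u, v) \<in> parcs G ^^ j \<Longrightarrow> k \<le> j"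
  shows "gdist (with_proj G) u v = k"
  unfolding gdist_eq_Least_relpow[OF assms(1,2)] by (rule Least_equality) (use assms in auto)

lemma relpow_gdist:
  assumes "pair_wf_digraph G" "u \<in> pverts G" "(u, v) \<in> (parcs G)\<^sup>*"
  shows "(u, v) \<in> parcs G ^^ gdist (with_proj G) u v"
  unfolding gdist_eq_Least_relpow[OF assms(1,2)]
  using assms(3) by (metis LeastI rtrancl_imp_relpow)

lemma gdist_le_diam:
  assumes "finite (verts G)" "u \<in> verts G" "v \<in> verts G"
  shows "gdist G u v \<le> diam G"
proof -
  have "{gdist G u v | u v. u \<in> verts G \<and> v \<in> verts G}
          = (\<lambda>(u, v). gdist G u v) ` (verts G \<times> verts G)"
    by auto
  then have "finite {gdist G u v | u v. u \<in> verts G \<and> v \<in> verts G}"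
    using assms(1) by simp
  then show ?thesis
    unfolding diam_def using assms by (intro Max_ge) auto
qed

section \<open>Vertex-transitive graphs are distance mean-regular\<close>

text \<open>
  An isometry maps spheres onto spheres and, being injective, commutes with intersections; the
  average is then reindexed along \<open>f\<close>.
\<close>

lemma mean_intersection_isometry:
  assumes bij: "bij_betw f (verts G) (verts G)"
    and iso: "\<And>x y. x \<in> verts G \<Longrightarrow> y \<in> verts G \<Longrightarrow> gdist G (f x) (f y) = gdist G x y"
    and u: "u \<in> verts G"
  shows "mean_intersection G h i j (f u) = mean_intersection G h i j u"
proof -
  have inj: "inj_on f (verts G)" and surj: "f ` verts G = verts G"
    using bij by (auto simp: bij_betw_def)
  have sub: "sphere G i x \<subseteq> verts G" for i x
    by (auto simp: sphere_def)
  have im: "sphere G i (f x) = f ` sphere G i x" if "x \<in> verts G" for i x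
  proof -
    have "sphere G i (f x) = {y \<in> f ` verts G. gdist G (f x) y = i}"
      by (simp add: sphere_def surj)
    also have "\<dots> = f ` sphere G i x"
      using iso[OF that] by (auto simp: sphere_def)
    finally show ?thesis .
  qed
  have inj_sphere: "inj_on f A" if "A \<subseteq> sphere G i x" for A i x
    using inj sub that by (meson inj_on_subset order_trans)
  have inter: "card (sphere G i (f u) \<inter> sphere G j (f v)) = card (sphere G i u \<inter> sphere G j v)"
    if "v \<in> verts G" for v
  proof -
    have "sphere G i (f u) \<inter> sphere G j (f v) = f ` (sphere G i u \<inter> sphere G j v)"
      using im[OF u] im[OF that] inj_on_image_Int[OF inj sub sub] by simp
    then show ?thesis
      by (simp add: card_image inj_sphere[where i = i and x = u])
  qed
  have "(\<Sum>v \<in> sphere G h (f u). real (card (sphere G i (f u) \<inter> sphere G j v)))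
          = (\<Sum>v \<in> sphere G h u. real (card (sphere G i (f u) \<inter> sphere G j (f v))))"
    unfolding im[OF u] by (simp add: sum.reindex inj_sphere[where i = h and x = u])
  also have "\<dots> = (\<Sum>v \<in> sphere G h u. real (card (sphere G i u \<inter> sphere G j v)))"
    using sub inter by (intro sum.cong) auto
  finally show ?thesis
    by (simp add: mean_intersection_def im[OF u] card_image inj_sphere[where i = h and x = u])
qed

text \<open>
  The surjectivity of \<open>f\<close> matters: every walk between images is itself an image, which shows that
  \<open>f\<close> does not shorten distances.
\<close>

lemma gdist_automorphism:
  assumes "pair_wf_digraph G"
    and bij: "bij_betw f (pverts G) (pverts G)"
    and arc: "\<And>x y. x \<in> pverts G \<Longrightarrow> y \<in> pverts G \<Longrightarrow> (f x, f y) \<in> parcs G \<longleftrightarrow> (x, y) \<in> parcs G"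
    and "u \<in> pverts G" "v \<in> pverts G"
  shows "gdist (with_proj G) (f u) (f v) = gdist (with_proj G) u v"
proof -
  interpret pair_wf_digraph G by fact
  have inj: "inj_on f (pverts G)" and surj: "f ` pverts G = pverts G"
    using bij by (auto simp: bij_betw_def)
  have "(f x, f v) \<in> parcs G ^^ k \<longleftrightarrow> (x, v) \<in> parcs G ^^ k" if "x \<in> pverts G" for k x
    using that
  proof (induction k arbitrary: x)
    case 0
    then show ?case using inj \<open>v \<in> pverts G\<close> by (auto dest: inj_onD)
  next
    case (Suc k)
    have "(f x, f v) \<in> parcs G ^^ Suc k \<longleftrightarrow>
            (\<exists>w \<in> f ` pverts G. (f x, w) \<in> parcs G \<and> (w, f v) \<in> parcs G ^^ k)"
      unfolding surj by (auto simp: relpow_Suc_iff simp del: relpow.simps dest: in_arcsD2)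
    also have "\<dots> \<longleftrightarrow> (\<exists>w \<in> pverts G. (x, w) \<in> parcs G \<and> (w, v) \<in> parcs G ^^ k)"
      using Suc arc by auto
    also have "\<dots> \<longleftrightarrow> (x, v) \<in> parcs G ^^ Suc k"
      by (auto simp: relpow_Suc_iff simp del: relpow.simps dest: in_arcsD2)
    finally show ?case .
  qed
  moreover have "f u \<in> pverts G"
    using surj \<open>u \<in> pverts G\<close> by auto
  ultimately show ?thesis
    using assms by (simp add: gdist_eq_Least_relpow)
qed

lemma vertex_transitive_imp_dmr:
  assumes "pair_wf_digraph G"
    and trans: "\<And>u u'. u \<in> pverts G \<Longrightarrow> u' \<in> pverts G \<Longrightarrow>
      \<exists>f. bij_betw f (pverts G) (pverts G) \<and> f u = u' \<and>
        (\<forall>x \<in> pverts G. \<forall>y \<in> pverts G. (f x, f y) \<in> parcs G \<longleftrightarrow> (x, y) \<in> parcs G)"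
  shows "dmr (with_proj G)"
  unfolding dmr_def
proof (intro ballI)
  fix h i j u u'
  assume u: "u \<in> verts (with_proj G)" "u' \<in> verts (with_proj G)"
  then obtain f where f: "bij_betw f (pverts G) (pverts G)" "f u = u'"
    "\<And>x y. x \<in> pverts G \<Longrightarrow> y \<in> pverts G \<Longrightarrow> (f x, f y) \<in> parcs G \<longleftrightarrow> (x, y) \<in> parcs G"
    using trans[of u u'] by auto
  show "mean_intersection (with_proj G) h i j u = mean_intersection (with_proj G) h i j u'"
    using mean_intersection_isometry[of f "with_proj G" u h i j] f u
      gdist_automorphism[OF assms(1) f(1) f(3)] by auto
qed

section \<open>Haar graphs of cyclic groups\<close>

text \<open>
  The bipartite graph on two copies of the integers modulo \<open>m\<close> that joins \<open>x\<close> in the first copy to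
  \<open>x\<close>, \<open>x + 1\<close> and \<open>x + 3\<close> in the second is the Haar graph with connection set \<open>{0, 1, 3}\<close>. Coding
  the first copy by \<open>2x\<close> and the second by \<open>2x + 1\<close> places it on the integers modulo \<open>2m\<close>, where the
  connection set becomes \<open>{1, 3, 7}\<close>; even vertices step forwards and odd vertices backwards.
\<close>

definition dir :: "int \<Rightarrow> int" where
  "dir a = (if even a then 1 else -1)"

definition haar_step :: "nat \<Rightarrow> int \<Rightarrow> int \<Rightarrow> bool" where
  "haar_step m a b \<longleftrightarrow> (\<exists>k \<in> {1, 3, 7}. 2 * int m dvd b - a - dir a * k)"

definition haar_graph :: "nat \<Rightarrow> nat pair_pre_digraph" where
  "haar_graph m = \<lparr> pverts = {..<2 * m},
     parcs = {(a, b). a < 2 * m \<and> b < 2 * m \<and> haar_step m (int a) (int b)} \<rparr>"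

lemma pverts_haar_graph [simp]: "pverts (haar_graph m) = {..<2 * m}"
  by (simp add: haar_graph_def)

lemma parcs_haar_graph:
  "(a, b) \<in> parcs (haar_graph m) \<longleftrightarrow> a < 2 * m \<and> b < 2 * m \<and> haar_step m (int a) (int b)"
  by (simp add: haar_graph_def)

lemma even_modulus_dvd: "2 * int m dvd x \<Longrightarrow> even x"
  by (rule dvd_trans[OF dvd_triv_left])

lemma haar_step_parity:
  assumes "haar_step m a b"
  shows "odd (b - a)"
proof -
  obtain k where k: "k \<in> {1, 3, 7::int}" "2 * int m dvd b - a - dir a * k"
    using assms unfolding haar_step_def by blast
  have "odd (dir a * k)"
    using k(1) by (auto simp: dir_def)
  then show ?thesis
    using even_modulus_dvd[OF k(2)] by simp
qed

lemma haar_step_sym: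
  assumes "haar_step m a b"
  shows "haar_step m b a"
proof -
  obtain k where k: "k \<in> {1, 3, 7::int}" "2 * int m dvd b - a - dir a * k"
    using assms unfolding haar_step_def by blast
  have "dir b = - dir a"
    using haar_step_parity[OF assms] by (auto simp: dir_def)
  then have "a - b - dir b * k = - (b - a - dir a * k)"
    by simp
  then show ?thesis
    using k by (metis dvd_minus_iff haar_step_def)
qed

lemma haar_step_cong:
  assumes a: "2 * int m dvd a' - a" and b: "2 * int m dvd b' - b"
  shows "haar_step m a' b' \<longleftrightarrow> haar_step m a b"
proof -
  have "dir a' = dir a"
    using even_modulus_dvd[OF a] by (auto simp: dir_def)
  moreover have "2 * int m dvd (b' - a' - x) - (b - a - x)" for x
    using dvd_diff[OF b a] by (simp add: algebra_simps)
  then have "2 * int m dvd b' - a' - x \<longleftrightarrow> 2 * int m dvd b - a - x" for x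
    using dvd_add_right_iff[of "2 * int m" "(b' - a' - x) - (b - a - x)" "b - a - x"]
    by (simp only: diff_add_cancel)
  ultimately show ?thesis
    by (simp add: haar_step_def)
qed

text \<open>
  This covers the even translations (\<open>e = 1\<close>) and the odd reflections (\<open>e = -1\<close>) at once: a
  reflection reverses the direction of a step, and the parity of \<open>c\<close> is such that it also exchanges
  forward-stepping and backward-stepping vertices.
\<close>

lemma haar_step_affine:
  assumes "even c \<longleftrightarrow> e = 1" "e \<in> {1, -1}"
  shows "haar_step m (c + e * a) (c + e * b) \<longleftrightarrow> haar_step m a b"
proof -
  have d: "dir (c + e * a) = e * dir a"
    using assms by (auto simp: dir_def)
  have "(c + e * b) - (c + e * a) - dir (c + e * a) * k = e * (b - a - dir a * k)" for k
    unfolding d by (simp add: algebra_simps)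
  moreover have "2 * int m dvd e * x \<longleftrightarrow> 2 * int m dvd x" for x
    using assms(2) by auto
  ultimately show ?thesis
    by (simp only: haar_step_def)
qed

lemma pair_graph_haar_graph: "pair_graph (haar_graph m)"
proof
  have "parcs (haar_graph m) \<subseteq> {..<2 * m} \<times> {..<2 * m}"
    by (simp add: haar_graph_def subset_iff)
  then show "finite (parcs (haar_graph m))"
    by (rule finite_subset) simp
  show "symmetric (with_proj (haar_graph m))"
    unfolding symmetric_def with_proj_simps
    by (rule symI) (simp add: parcs_haar_graph haar_step_sym)
next
  fix e assume "e \<in> parcs (haar_graph m)"
  then obtain a b where e: "e = (a, b)" "a < 2 * m" "b < 2 * m" "haar_step m (int a) (int b)"
    by (cases e) (simp add: parcs_haar_graph)
  show "fst e \<in> pverts (haar_graph m)" "snd e \<in> pverts (haar_graph m)"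
    by (simp_all add: e)
  show "fst e \<noteq> snd e"
    using haar_step_parity[OF e(4)] by (auto simp: e)
qed simp

lemma pair_wf_haar_graph: "pair_wf_digraph (haar_graph m)"
  using pair_graph_haar_graph pair_graph.axioms(1) pair_digraph.axioms(1) pair_fin_digraph.axioms(1)
  by blast

text \<open>
  Vertices of equal parity are related by a translation, vertices of opposite parity by a reflection.
\<close>

lemma haar_graph_vertex_transitive:
  assumes "u < 2 * m" "u' < 2 * m"
  shows "\<exists>f. bij_betw f {..<2 * m} {..<2 * m} \<and> f u = u' \<and>
    (\<forall>x < 2 * m. \<forall>y < 2 * m.
      (f x, f y) \<in> parcs (haar_graph m) \<longleftrightarrow> (x, y) \<in> parcs (haar_graph m))"
proof -
  let ?N = "2 * int m"
  define e where "e = dir (int u' - int u)"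
  define c where "c = int u' - e * int u"
  define f where "f x = nat ((c + e * int x) mod ?N)" for x :: nat
  have e: "e \<in> {1, -1}" "even c \<longleftrightarrow> e = 1"
    by (auto simp: e_def c_def dir_def)
  have N: "?N > 0"
    using assms by simp
  have int_f: "int (f x) = (c + e * int x) mod ?N" for x
    using N by (simp add: f_def)
  have f_lt: "f x < 2 * m" for x
    using pos_mod_bound[OF N, of "c + e * int x"] int_f[of x] by linarith
  have f_cong: "?N dvd int (f x) - (c + e * int x)" for x
    unfolding int_f by (simp add: mod_eq_dvd_iff[symmetric])
  have "inj_on f {..<2 * m}"
  proof (rule inj_onI)
    fix x y assume xy: "x \<in> {..<2 * m}" "y \<in> {..<2 * m}" "f x = f y"
    have "?N dvd (int (f x) - (c + e * int y)) - (int (f x) - (c + e * int x))"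
      using f_cong[of x] f_cong[of y] xy(3) by (metis dvd_diff)
    then have "?N dvd e * (int x - int y)"
      by (simp add: algebra_simps)
    then have "?N dvd int x - int y"
      using e(1) by (auto simp: dvd_diff_commute)
    then have "int x mod ?N = int y mod ?N"
      by (simp add: mod_eq_dvd_iff)
    then show "x = y"
      using xy(1,2) by simp
  qed
  then have "bij_betw f {..<2 * m} {..<2 * m}"
    using f_lt by (simp add: bij_betw_def endo_inj_surj image_subset_iff)
  moreover have "f u = u'"
    using assms by (simp add: f_def c_def)
  moreover have "(f x, f y) \<in> parcs (haar_graph m) \<longleftrightarrow> (x, y) \<in> parcs (haar_graph m)"
    if "x < 2 * m" "y < 2 * m" for x y
    using that f_lt haar_step_cong[OF f_cong f_cong] haar_step_affine[OF e(2,1)]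
    by (simp add: parcs_haar_graph)
  ultimately show ?thesis by blast
qed

lemma dmr_haar_graph: "dmr (with_proj (haar_graph m))"
  using vertex_transitive_imp_dmr[OF pair_wf_haar_graph] haar_graph_vertex_transitive
  by (metis lessThan_iff pverts_haar_graph)

lemma haar_arcI:
  assumes "a < 2 * m" "b < 2 * m" "int b - int a = dir (int a) * k" "k \<in> {1, 3, 7}"
  shows "(a, b) \<in> parcs (haar_graph m)"
proof -
  have "2 * int m dvd int b - int a - dir (int a) * k"
    by (simp add: assms(3))
  then show ?thesis
    unfolding parcs_haar_graph haar_step_def using assms by blast
qed

text \<open>
  An odd \<open>x\<close> is one step from \<open>x - 1\<close>; an even \<open>x\<close> is reached from \<open>x - 2\<close> by going \<open>3\<close> forwards and
  \<open>1\<close> backwards.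
\<close>

lemma haar_graph_reachable_from_0: "x < 2 * m \<Longrightarrow> (0, x) \<in> (parcs (haar_graph m))\<^sup>*"
proof (induction x rule: less_induct)
  case (less x)
  consider "x = 0" | "odd x" | "x \<ge> 2" "even x"
    by (cases "x = 0 \<or> odd x") (auto elim!: evenE)
  then show ?case
  proof cases
    case 2
    then have "(x - 1, x) \<in> parcs (haar_graph m)"
      using less.prems by (intro haar_arcI[of _ _ _ 1]) (auto simp: dir_def of_nat_diff elim!: oddE)
    then show ?thesis
      using less.IH[of "x - 1"] less.prems 2 by (auto intro: rtrancl_into_rtrancl elim!: oddE)
  next
    case 3
    have "x + 1 < 2 * m"
      using less.prems 3 by presburger
    then have "(x - 2, x + 1) \<in> parcs (haar_graph m)"
      using 3 by (intro haar_arcI[of _ _ _ 3]) (simp_all add: dir_def of_nat_diff)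
    moreover have "(x + 1, x) \<in> parcs (haar_graph m)"
      using 3 \<open>x + 1 < 2 * m\<close> by (intro haar_arcI[of _ _ _ 1]) (simp_all add: dir_def)
    moreover have "(0, x - 2) \<in> (parcs (haar_graph m))\<^sup>*"
      using less.IH[of "x - 2"] less.prems 3 by simp
    ultimately show ?thesis
      by (meson rtrancl_into_rtrancl)
  qed auto
qed

lemma haar_graph_reachable:
  assumes "u < 2 * m" "v < 2 * m"
  shows "(u, v) \<in> (parcs (haar_graph m))\<^sup>*"
proof -
  have "sym (parcs (haar_graph m))"
    by (auto intro!: symI simp: parcs_haar_graph haar_step_sym)
  then show ?thesis
    using haar_graph_reachable_from_0 assms by (meson rtrancl_trans symD sym_rtrancl)
qed

lemma connected_haar_graph:
  assumes "m > 0"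
  shows "Digraph_Component.connected (with_proj (haar_graph m))"
proof -
  interpret pair_wf_digraph "haar_graph m" by (rule pair_wf_haar_graph)
  have "strongly_connected (with_proj (haar_graph m))"
  proof (rule strongly_connectedI)
    show "verts (with_proj (haar_graph m)) \<noteq> {}"
      using assms by (auto simp: lessThan_empty_iff)
    fix u v assume "u \<in> verts (with_proj (haar_graph m))" "v \<in> verts (with_proj (haar_graph m))"
    then show "u \<rightarrow>\<^sup>*\<^bsub>with_proj (haar_graph m)\<^esub> v"
      using haar_graph_reachable[of u m v]
      by (metis lessThan_iff pverts_haar_graph reachable_refl reachable1_reachable rtranclD
          with_proj_simps(1,3))
  qed
  then have "(u, v) \<in> rtrancl_on {..<2 * m} ((parcs (haar_graph m))\<^sup>s)"
    if "u < 2 * m" "v < 2 * m" for u v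
    using that by (auto simp: strongly_connected_def reachable_def symcl_def intro: rtrancl_on_mono)
  then show ?thesis
    using assms by (simp add: connected_conv lessThan_empty_iff)
qed

text \<open>
  Lifting a walk to the integers: \<open>x\<close> is the displacement before reduction modulo \<open>2m\<close>.
\<close>

lemma haar_walk_displacement:
  assumes "(a, b) \<in> parcs (haar_graph m) ^^ k"
  shows "\<exists>x. 2 * int m dvd int b - int a - x \<and> \<bar>x\<bar> \<le> 7 * int k"
  using assms
proof (induction k arbitrary: b)
  case 0
  then show ?case by (intro exI[of _ 0]) auto
next
  case (Suc k)
  then obtain c where c: "(a, c) \<in> parcs (haar_graph m) ^^ k" "(c, b) \<in> parcs (haar_graph m)"
    by auto
  obtain x where x: "2 * int m dvd int c - int a - x" "\<bar>x\<bar> \<le> 7 * int k"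
    using Suc.IH[OF c(1)] by blast
  obtain l where l: "l \<in> {1, 3, 7::int}" "2 * int m dvd int b - int c - dir (int c) * l"
    using c(2) unfolding parcs_haar_graph haar_step_def by blast
  have "2 * int m dvd int b - int a - (x + dir (int c) * l)"
    using dvd_add[OF x(1) l(2)] by (simp add: algebra_simps)
  moreover have "\<bar>x + dir (int c) * l\<bar> \<le> 7 * int (Suc k)"
    using x(2) l(1) by (auto simp: dir_def)
  ultimately show ?case by blast
qed

text \<open>
  The vertex \<open>m\<close> is antipodal to \<open>0\<close> on the cycle of residues, so every displacement leading
  from \<open>0\<close> to it is an odd multiple of \<open>m\<close>.
\<close>

lemma diam_haar_graph:
  assumes "m > 0"
  shows "m \<le> 7 * diam (with_proj (haar_graph m))"
proof -
  let ?D = "gdist (with_proj (haar_graph m)) 0 m"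
  have "(0, m) \<in> parcs (haar_graph m) ^^ ?D"
    using assms by (intro relpow_gdist pair_wf_haar_graph haar_graph_reachable) auto
  then obtain x where x: "2 * int m dvd int m - x" "\<bar>x\<bar> \<le> 7 * int ?D"
    using haar_walk_displacement by fastforce
  then obtain t where "int m - x = 2 * int m * t"
    by (auto elim: dvdE)
  then have "x = int m * (1 - 2 * t)"
    by (simp add: algebra_simps)
  then have "\<bar>x\<bar> = int m * \<bar>1 - 2 * t\<bar>"
    by (simp add: abs_mult)
  moreover have "\<bar>1 - 2 * t\<bar> \<ge> 1"
    by presburger
  ultimately have "int m \<le> \<bar>x\<bar>"
    by (simp add: mult_le_cancel_left1)
  then have "m \<le> 7 * ?D"
    using x(2) by linarith
  moreover have "?D \<le> diam (with_proj (haar_graph m))"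
    using assms by (intro gdist_le_diam) auto
  ultimately show ?thesis by linarith
qed

section \<open>Failure of commutativity\<close>

lemma haar_walk_parity:
  "(a, b) \<in> parcs (haar_graph m) ^^ k \<Longrightarrow> even (int b - int a) \<longleftrightarrow> even k"
proof (induction k arbitrary: b)
  case (Suc k)
  then obtain c where c: "(a, c) \<in> parcs (haar_graph m) ^^ k" "(c, b) \<in> parcs (haar_graph m)"
    by auto
  then have "odd (int b - int c)"
    by (auto simp: parcs_haar_graph dest: haar_step_parity)
  then show ?case
    using Suc.IH[OF c(1)] by auto
qed auto

text \<open>
  The parity of the vertex alternates along a walk, so the second of three steps goes in the opposite
  direction to the other two.
\<close>

lemma haar_walk3:
  assumes "(a, b) \<in> parcs (haar_graph m) ^^ 3"
  shows "\<exists>k \<in> {1, 3, 7}. \<exists>l \<in> {1, 3, 7}. \<exists>n \<in> {1, 3, 7}.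
    2 * int m dvd int b - int a - dir (int a) * (k - l + n)"
proof -
  obtain c d where arcs: "(a, c) \<in> parcs (haar_graph m)" "(c, d) \<in> parcs (haar_graph m)"
      "(d, b) \<in> parcs (haar_graph m)"
    using assms by (auto simp: numeral_3_eq_3)
  then obtain k l n where kln: "k \<in> {1, 3, 7::int}" "l \<in> {1, 3, 7::int}" "n \<in> {1, 3, 7::int}"
      "2 * int m dvd int c - int a - dir (int a) * k"
      "2 * int m dvd int d - int c - dir (int c) * l"
      "2 * int m dvd int b - int d - dir (int d) * n"
    unfolding parcs_haar_graph haar_step_def by blast
  have "odd (int c - int a)" "odd (int d - int c)"
    using arcs by (auto simp: parcs_haar_graph dest: haar_step_parity)
  then have "dir (int c) = - dir (int a)" "dir (int d) = dir (int a)"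
    by (auto simp: dir_def)
  then have "2 * int m dvd int b - int a - dir (int a) * (k - l + n)"
    using dvd_add[OF dvd_add[OF kln(4,5)] kln(6)] by (simp add: algebra_simps)
  then show ?thesis
    using kln by blast
qed

lemma small_dvd_imp_0:
  assumes "2 * int m dvd x" "\<bar>x\<bar> < 2 * int m"
  shows "x = 0"
proof (rule ccontr)
  assume "x \<noteq> 0"
  from dvd_imp_le_int[OF this assms(1)] show False
    using assms(2) by simp
qed

text \<open>
  The bounds on \<open>m\<close> and \<open>a\<close> prevent the steps from wrapping around modulo \<open>2m\<close>.
\<close>

lemma haar_nbr:
  assumes "m \<ge> 20" "(a, b) \<in> parcs (haar_graph m)" "even a" "a \<le> 10"
  shows "b \<in> {a + 1, a + 3, a + 7}"
proof -
  have "dir (int a) = 1"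
    using assms(3) by (simp add: dir_def)
  then obtain k where k: "k \<in> {1, 3, 7::int}" "2 * int m dvd int b - int a - k" "b < 2 * m"
    using assms(2) unfolding parcs_haar_graph haar_step_def by (metis mult_1)
  have "\<bar>int b - int a - k\<bar> < 2 * int m"
    using k(1,3) assms(1,4) by auto
  then show ?thesis
    using small_dvd_imp_0[OF k(2)] k(1) by auto
qed

lemma haar_gdist_1:
  assumes "a < 2 * m" "b < 2 * m" "gdist (with_proj (haar_graph m)) a b = 1"
  shows "(a, b) \<in> parcs (haar_graph m)"
  using relpow_gdist[OF pair_wf_haar_graph, of a m b] haar_graph_reachable assms by auto

lemma haar_gdist_arc:
  assumes "(a, b) \<in> parcs (haar_graph m)"
  shows "gdist (with_proj (haar_graph m)) a b = 1"
proof (rule gdist_eqI[OF pair_wf_haar_graph])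
  show "a \<in> pverts (haar_graph m)" "(a, b) \<in> parcs (haar_graph m) ^^ 1"
    using assms by (auto simp: parcs_haar_graph)
  have "odd (int b - int a)"
    using assms haar_step_parity unfolding parcs_haar_graph by blast
  then show "1 \<le> j" if "(a, b) \<in> parcs (haar_graph m) ^^ j" for j
    using haar_walk_parity[OF that] by (metis even_zero less_one not_le)
qed

text \<open>
  The graph is bipartite, so for a pair joined by a walk of length three only distance \<open>1\<close> has to be
  excluded.
\<close>

lemma haar_gdist_3:
  assumes "(a, b) \<in> parcs (haar_graph m) ^^ 3" "(a, b) \<notin> parcs (haar_graph m)" "a < 2 * m"
  shows "gdist (with_proj (haar_graph m)) a b = 3"
proof (rule gdist_eqI[OF pair_wf_haar_graph])
  show "3 \<le> j" if "(a, b) \<in> parcs (haar_graph m) ^^ j" for j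
  proof -
    have "odd j"
      using haar_walk_parity[OF that] haar_walk_parity[OF assms(1)] by simp
    moreover have "j \<noteq> 1"
      using that assms(2) by auto
    ultimately show ?thesis by presburger
  qed
qed (use assms in auto)

text \<open>
  The pair \<open>0\<close>, \<open>10\<close> with radii \<open>1\<close> and \<open>3\<close> violates commutativity. The bound on \<open>m\<close> makes the modulus at
  least \<open>40\<close>, so that congruences between the small displacements involved become equalities.
\<close>

lemma not_cddr_haar_graph:
  assumes "m \<ge> 20"
  shows "\<not> cddr (with_proj (haar_graph m))"
proof
  let ?G = "with_proj (haar_graph m)" and ?E = "parcs (haar_graph m)"
  assume cddr: "cddr ?G"
  \<comment> \<open>The walks \<open>0, 7, 4, 11\<close> and \<open>0, 7, 6, 13\<close> reach two neighbours of \<open>10\<close>.\<close>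
  have "(7, 6) \<in> ?E" "(10, 11) \<in> ?E"
    using assms by (auto intro!: haar_arcI[of _ _ _ 1] simp: dir_def)
  moreover have "(7, 4) \<in> ?E" "(10, 13) \<in> ?E"
    using assms by (auto intro!: haar_arcI[of _ _ _ 3] simp: dir_def)
  moreover have "(0, 7) \<in> ?E" "(4, 11) \<in> ?E" "(6, 13) \<in> ?E"
    using assms by (auto intro!: haar_arcI[of _ _ _ 7] simp: dir_def)
  ultimately have E: "(0, 7) \<in> ?E" "(7, 4) \<in> ?E" "(4, 11) \<in> ?E" "(7, 6) \<in> ?E" "(6, 13) \<in> ?E"
      "(10, 11) \<in> ?E" "(10, 13) \<in> ?E"
    by blast+
  have far: "gdist ?G 0 11 = 3" "gdist ?G 0 13 = 3"
  proof -
    have "(0, 11) \<in> ?E ^^ 3" "(0, 13) \<in> ?E ^^ 3"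
      using E unfolding numeral_3_eq_3 by auto
    moreover have "(0, 11) \<notin> ?E" "(0, 13) \<notin> ?E"
      using haar_nbr[OF assms, of 0 11] haar_nbr[OF assms, of 0 13] by auto
    ultimately show "gdist ?G 0 11 = 3" "gdist ?G 0 13 = 3"
      using assms by (simp_all add: haar_gdist_3)
  qed
  have sub: "{11, 13} \<subseteq> sphere ?G 1 10 \<inter> sphere ?G 3 0"
    using E assms far by (auto simp: sphere_def haar_gdist_arc)
  have "finite (sphere ?G 1 10 \<inter> sphere ?G 3 0)"
    by (auto simp: sphere_def)
  from card_mono[OF this sub] have two: "card (sphere ?G 1 10 \<inter> sphere ?G 3 0) \<ge> 2"
    by simp
  \<comment> \<open>The neighbours \<open>1\<close> and \<open>3\<close> of \<open>0\<close> lie further behind \<open>10\<close> than three steps can go.\<close>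
  have "sphere ?G 1 0 \<inter> sphere ?G 3 10 \<subseteq> {7}"
  proof
    fix x assume x: "x \<in> sphere ?G 1 0 \<inter> sphere ?G 3 10"
    then have "x \<in> {1, 3, 7}"
      using haar_gdist_1[of 0 m x] haar_nbr[OF assms, of 0 x] by (auto simp: sphere_def)
    moreover have walk: "(10, x) \<in> ?E ^^ 3"
      using x relpow_gdist[OF pair_wf_haar_graph, of 10 m x] haar_graph_reachable[of 10 m x] assms
      by (auto simp: sphere_def)
    have "int 10 = 10" "dir (int 10) = 1"
      by (simp_all add: dir_def)
    with haar_walk3[OF walk] obtain k l n
      where kln: "k \<in> {1, 3, 7::int}" "l \<in> {1, 3, 7::int}" "n \<in> {1, 3, 7::int}"
        "2 * int m dvd int x - 10 - (k - l + n)"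
      by (metis mult_1)
    \<comment> \<open>For \<open>x = 1\<close> and \<open>x = 3\<close> the left side is below \<open>1 - 7 + 1 = -5\<close>, the least value of the right side.\<close>
    have "int x - 10 = k - l + n" if "x \<le> 7"
      using small_dvd_imp_0[OF kln(4)] kln(1-3) assms that by auto
    ultimately show "x \<in> {7}"
      using kln(1-3) by auto
  qed
  from card_mono[OF _ this] have "card (sphere ?G 1 0 \<inter> sphere ?G 3 10) \<le> 1"
    by simp
  moreover have "3 \<le> diam ?G"
    using gdist_le_diam[of ?G 0 11] far(1) assms by simp
  then have "card (sphere ?G 1 0 \<inter> sphere ?G 3 10) = card (sphere ?G 1 10 \<inter> sphere ?G 3 0)"
    using cddr assms by (simp add: cddr_def)
  ultimately show False
    using two by linarith
qed

theorem corollary3p15: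
  fixes n d :: nat
  shows "\<exists>G :: nat pair_pre_digraph. pair_graph G \<and> Digraph_Component.connected (with_proj G) \<and>
           card (pverts G) \<ge> n \<and> diam (with_proj G) \<ge> d \<and>
           dmr (with_proj G) \<and> \<not> cddr (with_proj G)"
proof (intro exI conjI)
  let ?m = "n + 7 * d + 20"
  show "pair_graph (haar_graph ?m)"
    by (rule pair_graph_haar_graph)
  show "Digraph_Component.connected (with_proj (haar_graph ?m))"
    by (rule connected_haar_graph) simp
  show "card (pverts (haar_graph ?m)) \<ge> n"
    by simp
  show "diam (with_proj (haar_graph ?m)) \<ge> d"
    using diam_haar_graph[of ?m] by simp
  show "dmr (with_proj (haar_graph ?m))"
    by (rule dmr_haar_graph)
  show "\<not> cddr (with_proj (haar_graph ?m))"
    by (rule not_cddr_haar_graph) simp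
qed

end
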